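(* Let $\mathcal{Q}$ be a small quantaloid and let $F:\mathbb{A}\to\mathbb{B}$ be a $\mathcal{Q}$-functor between $\mathcal{Q}$-categories, with graph $F_{\natural}:\mathbb{A}\nrightarrow\mathbb{B}$ and cograph $F^{\natural}:\mathbb{B}\nrightarrow\mathbb{A}$. Then $$(F^{\natural})^*\dashv (F^{\natural})_*= F^{\leftarrow}=(F_{\natural})^*\dashv(F_{\natural})_*,$$ that is, $(F^{\natural})_*=F^{\leftarrow}=(F_{\natural})^*$ as $\mathcal{Q}$-functors $\mathcal{P}\mathbb{B}\to\mathcal{P}\mathbb{A}$, this $\mathcal{Q}$-functor has left adjoint $(F^{\natural})^*:\mathcal{P}\mathbb{A}\to\mathcal{P}\mathbb{B}$, and it has right adjoint $(F_{\natural})_*:\mathcal{P}\mathbb{A}\to\mathcal{P}\mathbb{B}$.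
   Context: A small quantaloid $\mathcal{Q}$ is a category with a set $\mathcal{Q}_0$ of objects, each hom-set $\mathcal{Q}(A,B)$ a complete lattice, and composition $\circ$ preserving arbitrary joins in each variable. For $f\in\mathcal{Q}(A,B)$ and $g\in\mathcal{Q}(A,X)$, $g\swarrow f\in\mathcal{Q}(B,X)$ is the largest $h$ with $h\circ f\le g$. A $\mathcal{Q}$-category $\mathbb{A}$ is a set $\mathbb{A}_0$ with a type map $t:\mathbb{A}_0\to\mathcal{Q}_0$ and hom-arrows $\mathbb{A}(x,y)\in\mathcal{Q}(tx,ty)$ such that $1_{tx}\le\mathbb{A}(x,x)$ and $\mathbb{A}(y,z)\circ\mathbb{A}(x,y)\le\mathbb{A}(x,z)$. A $\mathcal{Q}$-functor $F:\mathbb{A}\to\mathbb{B}$ is a type-preserving map $\mathbb{A}_0\to\mathbb{B}_0$ with $\mathbb{A}(x,x')\le\mathbb{B}(Fx,Fx')$. Underlying preorder: $x\le y$ iff $tx=ty$ and $1_{tx}\le\mathbb{A}(x,y)$; $\mathcal{Q}$-functors are preordered pointwise. $F\dashv G$ (for $F:\mathbb{A}\to\mathbb{B}$, $G:\mathbb{B}\to\mathbb{A}$) means $1_{\mathbb{A}}\le G\circ F$ and $F\circ G\le 1_{\mathbb{B}}$. A $\mathcal{Q}$-distributor $\phi:\mathbb{A}\nrightarrow\mathbb{B}$ is a family $\phi(x,y)\in\mathcal{Q}(tx,ty)$ ($x\in\mathbb{A}_0,y\in\mathbb{B}_0$) with $\mathbb{B}(y',y)\circ\phi(x,y')\le\phi(x,y)$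 and $\phi(x',y)\circ\mathbb{A}(x,x')\le\phi(x,y)$. For $\phi:\mathbb{A}\nrightarrow\mathbb{B}$, $\psi:\mathbb{B}\nrightarrow\mathbb{C}$, $\eta:\mathbb{A}\nrightarrow\mathbb{C}$: $(\psi\circ\phi)(x,z)=\bigvee_y\psi(y,z)\circ\phi(x,y)$; $\eta\swarrow\phi:\mathbb{B}\nrightarrow\mathbb{C}$ is $(\eta\swarrow\phi)(y,z)=\bigwedge_x\eta(x,z)\swarrow\phi(x,y)$. The graph and cograph of $F:\mathbb{A}\to\mathbb{B}$ are $F_{\natural}(x,y)=\mathbb{B}(Fx,y)$ and $F^{\natural}(y,x)=\mathbb{B}(y,Fx)$. For $X\in\mathcal{Q}_0$, $*_X$ is the $\mathcal{Q}$-category with one object $*$ of type $X$ and hom-arrow $1_X$. $\mathcal{P}\mathbb{A}$ is the $\mathcal{Q}$-category whose objects of type $X$ are the distributors $\mu:\mathbb{A}\nrightarrow *_X$, with $\mathcal{P}\mathbb{A}(\mu,\lambda)=\lambda\swarrow\mu$. $F^{\leftarrow}:\mathcal{P}\mathbb{B}\to\mathcal{P}\mathbb{A}$ is $F^{\leftarrow}(\lambda)=\lambda\circ F_{\natural}$; explicitly $F^{\leftarrow}(\lambda)(x)=\lambda(Fx)$. For any distributor $\phi:\mathbb{A}\nrightarrow\mathbb{B}$, $\phi^*:\mathcal{P}\mathbb{B}\to\mathcal{P}\mathbb{A}$ is $\phi^*(\lambda)=\lambda\circ\phi$ and $\phi_*:\mathcal{P}\mathbb{A}\to\mathcal{P}\mathbb{B}$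 is $\phi_*(\mu)=\mu\swarrow\phi$. *)

theory Defs
  imports "HOL-Algebra.Complete_Lattice" "HOL-Library.FuncSet"
begin

section \<open>Quantaloids\<close>

text \<open>
  Hom-sets are carriers of HOL-Algebra orders and need not be disjoint, so composition carries its
  three objects: \<open>Comp Q A B C g f\<close> is \<open>g \<circ> f\<close> for \<open>f \<in> Q(A,B)\<close> and \<open>g \<in> Q(B,C)\<close>.
\<close>

record ('o, 'q) quantaloid_data =
  Ob :: "'o set"
  Hom :: "'o \<Rightarrow> 'o \<Rightarrow> 'q gorder"
  Comp :: "'o \<Rightarrow> 'o \<Rightarrow> 'o \<Rightarrow> 'q \<Rightarrow> 'q \<Rightarrow> 'q"
  Ident :: "'o \<Rightarrow> 'q"

locale quantaloid =
  fixes Q :: "('o, 'q) quantaloid_data"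
  assumes hom_complete_lattice:
      "\<lbrakk>A \<in> Ob Q; B \<in> Ob Q\<rbrakk> \<Longrightarrow> complete_lattice (Hom Q A B)"
    and Comp_closed:
      "\<lbrakk>A \<in> Ob Q; B \<in> Ob Q; C \<in> Ob Q; f \<in> carrier (Hom Q A B); g \<in> carrier (Hom Q B C)\<rbrakk>
        \<Longrightarrow> Comp Q A B C g f \<in> carrier (Hom Q A C)"
    and Ident_closed: "A \<in> Ob Q \<Longrightarrow> Ident Q A \<in> carrier (Hom Q A A)"
    and Comp_assoc:
      "\<lbrakk>A \<in> Ob Q; B \<in> Ob Q; C \<in> Ob Q; D \<in> Ob Q;
        f \<in> carrier (Hom Q A B); g \<in> carrier (Hom Q B C); h \<in> carrier (Hom Q C D)\<rbrakk>
        \<Longrightarrow> Comp Q A C D h (Comp Q A B C g f) = Comp Q A B D (Comp Q B C D h g) f"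
    and Comp_Ident_left:
      "\<lbrakk>A \<in> Ob Q; B \<in> Ob Q; f \<in> carrier (Hom Q A B)\<rbrakk> \<Longrightarrow> Comp Q A B B (Ident Q B) f = f"
    and Comp_Ident_right:
      "\<lbrakk>A \<in> Ob Q; B \<in> Ob Q; f \<in> carrier (Hom Q A B)\<rbrakk> \<Longrightarrow> Comp Q A A B f (Ident Q A) = f"
    and Comp_Sup_right:
      "\<lbrakk>A \<in> Ob Q; B \<in> Ob Q; C \<in> Ob Q; S \<subseteq> carrier (Hom Q A B); g \<in> carrier (Hom Q B C)\<rbrakk>
        \<Longrightarrow> Comp Q A B C g (\<Squnion>\<^bsub>Hom Q A B\<^esub> S) = \<Squnion>\<^bsub>Hom Q A C\<^esub> (Comp Q A B C g ` S)"
    and Comp_Sup_left: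
      "\<lbrakk>A \<in> Ob Q; B \<in> Ob Q; C \<in> Ob Q; f \<in> carrier (Hom Q A B); S \<subseteq> carrier (Hom Q B C)\<rbrakk>
        \<Longrightarrow> Comp Q A B C (\<Squnion>\<^bsub>Hom Q B C\<^esub> S) f
            = \<Squnion>\<^bsub>Hom Q A C\<^esub> ((\<lambda>g. Comp Q A B C g f) ` S)"

text \<open>\<open>right_imp Q A B X g f\<close> is \<open>g \<swarrow> f \<in> Q(B,X)\<close> for \<open>f \<in> Q(A,B)\<close> and \<open>g \<in> Q(A,X)\<close>.\<close>

definition right_imp ::
    "('o, 'q) quantaloid_data \<Rightarrow> 'o \<Rightarrow> 'o \<Rightarrow> 'o \<Rightarrow> 'q \<Rightarrow> 'q \<Rightarrow> 'q" where
  "right_imp Q A B X g f =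
    (THE h. greatest (Hom Q B X) h
      {h \<in> carrier (Hom Q B X). Comp Q A B X h f \<sqsubseteq>\<^bsub>Hom Q A X\<^esub> g})"

section \<open>Categories, functors and distributors over a quantaloid\<close>

record ('x, 'o, 'q) qcat =
  Obj :: "'x set"
  Ty :: "'x \<Rightarrow> 'o"
  Arr :: "'x \<Rightarrow> 'x \<Rightarrow> 'q"

locale qcategory = quantaloid Q
  for Q :: "('o, 'q) quantaloid_data" +
  fixes A :: "('x, 'o, 'q) qcat"
  assumes Ty_closed: "x \<in> Obj A \<Longrightarrow> Ty A x \<in> Ob Q"
    and Arr_closed:
      "\<lbrakk>x \<in> Obj A; y \<in> Obj A\<rbrakk> \<Longrightarrow> Arr A x y \<in> carrier (Hom Q (Ty A x) (Ty A y))"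
    and Arr_Ident: "x \<in> Obj A \<Longrightarrow> Ident Q (Ty A x) \<sqsubseteq>\<^bsub>Hom Q (Ty A x) (Ty A x)\<^esub> Arr A x x"
    and Arr_Comp:
      "\<lbrakk>x \<in> Obj A; y \<in> Obj A; z \<in> Obj A\<rbrakk>
        \<Longrightarrow> Comp Q (Ty A x) (Ty A y) (Ty A z) (Arr A y z) (Arr A x y)
              \<sqsubseteq>\<^bsub>Hom Q (Ty A x) (Ty A z)\<^esub> Arr A x z"

definition underlying_le ::
    "('o, 'q) quantaloid_data \<Rightarrow> ('x, 'o, 'q) qcat \<Rightarrow> 'x \<Rightarrow> 'x \<Rightarrow> bool" where
  "underlying_le Q A x y \<longleftrightarrow>
    Ty A x = Ty A y \<and> Ident Q (Ty A x) \<sqsubseteq>\<^bsub>Hom Q (Ty A x) (Ty A x)\<^esub> Arr A x y"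

text \<open>
  Functors and distributors are extensional functions on their carriers, so that equality in HOL
  is equality of functors and of distributors.
\<close>

locale qfunctor = dom: qcategory Q A + cod: qcategory Q B
  for Q :: "('o, 'q) quantaloid_data"
    and A :: "('x, 'o, 'q) qcat" and B :: "('y, 'o, 'q) qcat" +
  fixes F :: "'x \<Rightarrow> 'y"
  assumes map_closed: "F \<in> Obj A \<rightarrow>\<^sub>E Obj B"
    and map_Ty: "x \<in> Obj A \<Longrightarrow> Ty B (F x) = Ty A x"
    and map_Arr:
      "\<lbrakk>x \<in> Obj A; x' \<in> Obj A\<rbrakk>
        \<Longrightarrow> Arr A x x' \<sqsubseteq>\<^bsub>Hom Q (Ty A x) (Ty A x')\<^esub> Arr B (F x) (F x')"

definition functor_le ::
    "('o, 'q) quantaloid_data \<Rightarrow> ('x, 'o, 'q) qcat \<Rightarrow> ('y, 'o, 'q) qcat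
      \<Rightarrow> ('x \<Rightarrow> 'y) \<Rightarrow> ('x \<Rightarrow> 'y) \<Rightarrow> bool" where
  "functor_le Q A B F G \<longleftrightarrow> (\<forall>x\<in>Obj A. underlying_le Q B (F x) (G x))"

text \<open>\<open>qadjunction Q A B F G\<close> is \<open>F \<stileturn> G\<close> for functors \<open>F : A \<rightarrow> B\<close> and \<open>G : B \<rightarrow> A\<close>.\<close>

locale qadjunction = left: qfunctor Q A B F + right: qfunctor Q B A G
  for Q :: "('o, 'q) quantaloid_data"
    and A :: "('x, 'o, 'q) qcat" and B :: "('y, 'o, 'q) qcat"
    and F :: "'x \<Rightarrow> 'y" and G :: "'y \<Rightarrow> 'x" +
  assumes unit: "functor_le Q A A (\<lambda>x\<in>Obj A. x) (compose (Obj A) G F)"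
    and counit: "functor_le Q B B (compose (Obj B) F G) (\<lambda>y\<in>Obj B. y)"

locale qdistributor = dom: qcategory Q A + cod: qcategory Q B
  for Q :: "('o, 'q) quantaloid_data"
    and A :: "('x, 'o, 'q) qcat" and B :: "('y, 'o, 'q) qcat" +
  fixes \<phi> :: "'x \<Rightarrow> 'y \<Rightarrow> 'q"
  assumes dist_closed: "\<phi> \<in> (\<Pi>\<^sub>E x\<in>Obj A. \<Pi>\<^sub>E y\<in>Obj B. carrier (Hom Q (Ty A x) (Ty B y)))"
    and dist_cod:
      "\<lbrakk>x \<in> Obj A; y' \<in> Obj B; y \<in> Obj B\<rbrakk>
        \<Longrightarrow> Comp Q (Ty A x) (Ty B y') (Ty B y) (Arr B y' y) (\<phi> x y')
              \<sqsubseteq>\<^bsub>Hom Q (Ty A x) (Ty B y)\<^esub> \<phi> x y"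
    and dist_dom:
      "\<lbrakk>x \<in> Obj A; x' \<in> Obj A; y \<in> Obj B\<rbrakk>
        \<Longrightarrow> Comp Q (Ty A x) (Ty A x') (Ty B y) (\<phi> x' y) (Arr A x x')
              \<sqsubseteq>\<^bsub>Hom Q (Ty A x) (Ty B y)\<^esub> \<phi> x y"

text \<open>\<open>\<psi> \<circ> \<phi> : A \<rightarrow> C\<close> for distributors \<open>\<phi> : A \<rightarrow> B\<close> and \<open>\<psi> : B \<rightarrow> C\<close>.\<close>

definition dist_comp ::
    "('o, 'q) quantaloid_data \<Rightarrow> ('x, 'o, 'q) qcat \<Rightarrow> ('y, 'o, 'q) qcat \<Rightarrow> ('z, 'o, 'q) qcat
      \<Rightarrow> ('y \<Rightarrow> 'z \<Rightarrow> 'q) \<Rightarrow> ('x \<Rightarrow> 'y \<Rightarrow> 'q) \<Rightarrow> ('x \<Rightarrow> 'z \<Rightarrow> 'q)" where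
  "dist_comp Q A B C \<psi> \<phi> =
    (\<lambda>x\<in>Obj A. \<lambda>z\<in>Obj C. \<Squnion>\<^bsub>Hom Q (Ty A x) (Ty C z)\<^esub>
      ((\<lambda>y. Comp Q (Ty A x) (Ty B y) (Ty C z) (\<psi> y z) (\<phi> x y)) ` Obj B))"

text \<open>\<open>\<eta> \<swarrow> \<phi> : B \<rightarrow> C\<close> for distributors \<open>\<phi> : A \<rightarrow> B\<close> and \<open>\<eta> : A \<rightarrow> C\<close>.\<close>

definition dist_imp ::
    "('o, 'q) quantaloid_data \<Rightarrow> ('x, 'o, 'q) qcat \<Rightarrow> ('y, 'o, 'q) qcat \<Rightarrow> ('z, 'o, 'q) qcat
      \<Rightarrow> ('x \<Rightarrow> 'z \<Rightarrow> 'q) \<Rightarrow> ('x \<Rightarrow> 'y \<Rightarrow> 'q) \<Rightarrow> ('y \<Rightarrow> 'z \<Rightarrow> 'q)" where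
  "dist_imp Q A B C \<eta> \<phi> =
    (\<lambda>y\<in>Obj B. \<lambda>z\<in>Obj C. \<Sqinter>\<^bsub>Hom Q (Ty B y) (Ty C z)\<^esub>
      ((\<lambda>x. right_imp Q (Ty A x) (Ty B y) (Ty C z) (\<eta> x z) (\<phi> x y)) ` Obj A))"

definition graph ::
    "('x, 'o, 'q) qcat \<Rightarrow> ('y, 'o, 'q) qcat \<Rightarrow> ('x \<Rightarrow> 'y) \<Rightarrow> ('x \<Rightarrow> 'y \<Rightarrow> 'q)" where
  "graph A B F = (\<lambda>x\<in>Obj A. \<lambda>y\<in>Obj B. Arr B (F x) y)"

definition cograph ::
    "('x, 'o, 'q) qcat \<Rightarrow> ('y, 'o, 'q) qcat \<Rightarrow> ('x \<Rightarrow> 'y) \<Rightarrow> ('y \<Rightarrow> 'x \<Rightarrow> 'q)" where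
  "cograph A B F = (\<lambda>y\<in>Obj B. \<lambda>x\<in>Obj A. Arr B y (F x))"

section \<open>Presheaves\<close>

definition star :: "('o, 'q) quantaloid_data \<Rightarrow> 'o \<Rightarrow> (unit, 'o, 'q) qcat" where
  "star Q X = \<lparr>Obj = {()}, Ty = (\<lambda>_. X), Arr = (\<lambda>_ _. Ident Q X)\<rparr>"

text \<open>
  A presheaf is stored together with its type, which the bare family of arrows does not determine
  (for instance when the category is empty).
\<close>

type_synonym ('x, 'o, 'q) presheaf = "'o \<times> ('x \<Rightarrow> unit \<Rightarrow> 'q)"

definition presheaves ::
    "('o, 'q) quantaloid_data \<Rightarrow> ('x, 'o, 'q) qcat \<Rightarrow> (('x, 'o, 'q) presheaf, 'o, 'q) qcat" where
  "presheaves Q A =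
    \<lparr>Obj = {(X, \<mu>). X \<in> Ob Q \<and> qdistributor Q A (star Q X) \<mu>},
     Ty = fst,
     Arr = (\<lambda>(X, \<mu>) (Y, \<kappa>). dist_imp Q A (star Q X) (star Q Y) \<kappa> \<mu> () ())\<rparr>"

text \<open>For \<open>\<phi> : A \<rightarrow> B\<close>: \<open>\<phi>\<^sup>*(\<kappa>) = \<kappa> \<circ> \<phi>\<close> and \<open>\<phi>\<^sub>*(\<mu>) = \<mu> \<swarrow> \<phi>\<close>.\<close>

definition upper_star ::
    "('o, 'q) quantaloid_data \<Rightarrow> ('x, 'o, 'q) qcat \<Rightarrow> ('y, 'o, 'q) qcat \<Rightarrow> ('x \<Rightarrow> 'y \<Rightarrow> 'q)
      \<Rightarrow> ('y, 'o, 'q) presheaf \<Rightarrow> ('x, 'o, 'q) presheaf" where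
  "upper_star Q A B \<phi> =
    (\<lambda>(X, \<kappa>)\<in>Obj (presheaves Q B). (X, dist_comp Q A B (star Q X) \<kappa> \<phi>))"

definition lower_star ::
    "('o, 'q) quantaloid_data \<Rightarrow> ('x, 'o, 'q) qcat \<Rightarrow> ('y, 'o, 'q) qcat \<Rightarrow> ('x \<Rightarrow> 'y \<Rightarrow> 'q)
      \<Rightarrow> ('x, 'o, 'q) presheaf \<Rightarrow> ('y, 'o, 'q) presheaf" where
  "lower_star Q A B \<phi> =
    (\<lambda>(X, \<mu>)\<in>Obj (presheaves Q A). (X, dist_imp Q A B (star Q X) \<mu> \<phi>))"

definition inverse_image ::
    "('o, 'q) quantaloid_data \<Rightarrow> ('x, 'o, 'q) qcat \<Rightarrow> ('y, 'o, 'q) qcat \<Rightarrow> ('x \<Rightarrow> 'y)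
      \<Rightarrow> ('y, 'o, 'q) presheaf \<Rightarrow> ('x, 'o, 'q) presheaf" where
  "inverse_image Q A B F =
    (\<lambda>(X, \<kappa>)\<in>Obj (presheaves Q B). (X, dist_comp Q A B (star Q X) \<kappa> (graph A B F)))"

text \<open>The explicit form \<open>F\<^sup>\<leftarrow>(\<kappa>)(x) = \<kappa>(F x)\<close>.\<close>

lemma (in quantaloid) Comp_mono_right:
  assumes "A \<in> Ob Q" "B \<in> Ob Q" "C \<in> Ob Q" "f \<in> carrier (Hom Q A B)"
    and "f' \<in> carrier (Hom Q A B)" "g \<in> carrier (Hom Q B C)" "f \<sqsubseteq>\<^bsub>Hom Q A B\<^esub> f'"
  shows "Comp Q A B C g f \<sqsubseteq>\<^bsub>Hom Q A C\<^esub> Comp Q A B C g f'"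
proof -
  interpret AB: complete_lattice "Hom Q A B" using assms hom_complete_lattice by blast
  interpret AC: complete_lattice "Hom Q A C" using assms hom_complete_lattice by blast
  have "f' = \<Squnion>\<^bsub>Hom Q A B\<^esub> {f, f'}"
    using assms by (intro AB.le_antisym AB.sup_upper AB.sup_least) (auto simp: Upper_def)
  then have "Comp Q A B C g f' = \<Squnion>\<^bsub>Hom Q A C\<^esub> {Comp Q A B C g f, Comp Q A B C g f'}"
    using assms Comp_Sup_right[of A B C "{f, f'}" g] by simp
  then show ?thesis
    using assms Comp_closed
      AC.sup_upper[of "{Comp Q A B C g f, Comp Q A B C g f'}" "Comp Q A B C g f"] by simp
qed

lemma (in qfunctor) inverse_image_apply:
  assumes "(X, \<kappa>) \<in> Obj (presheaves Q B)"
  shows "inverse_image Q A B F (X, \<kappa>) = (X, \<lambda>x\<in>Obj A. \<lambda>u\<in>{()}. \<kappa> (F x) u)"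
proof -
  have X: "X \<in> Ob Q" and "qdistributor Q B (star Q X) \<kappa>"
    using assms by (auto simp: presheaves_def)
  then interpret \<kappa>: qdistributor Q B "star Q X" \<kappa> by simp
  have "(\<Squnion>\<^bsub>Hom Q (Ty A x) X\<^esub>
      ((\<lambda>y. Comp Q (Ty A x) (Ty B y) X (\<kappa> y ()) (Arr B (F x) y)) ` Obj B)) = \<kappa> (F x) ()"
    (is "\<Squnion>\<^bsub>?L\<^esub> (?f ` _) = _") if x: "x \<in> Obj A" for x
  proof -
    have tx: "Ty A x \<in> Ob Q" using x by (rule dom.Ty_closed)
    have Fx: "F x \<in> Obj B" and tFx: "Ty B (F x) = Ty A x"
      using x map_closed map_Ty by auto
    interpret L: complete_lattice ?L using tx X by (rule dom.hom_complete_lattice)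
    have cl: "\<kappa> y () \<in> carrier (Hom Q (Ty B y) X)" if "y \<in> Obj B" for y
      using \<kappa>.dist_closed that by (auto simp: star_def PiE_iff)
    have arr: "Arr B (F x) y \<in> carrier (Hom Q (Ty A x) (Ty B y))" if "y \<in> Obj B" for y
      using cod.Arr_closed[OF Fx that] tFx by simp
    have cl_x: "\<kappa> (F x) () \<in> carrier ?L" using cl[OF Fx] tFx by simp
    have sub: "?f ` Obj B \<subseteq> carrier ?L"
      using cl arr tx X by (auto intro!: dom.Comp_closed simp: cod.Ty_closed)
    have "\<Squnion>\<^bsub>?L\<^esub> (?f ` Obj B) \<sqsubseteq>\<^bsub>?L\<^esub> \<kappa> (F x) ()"
      using sub cl_x \<kappa>.dist_dom[OF Fx] tFx
      by (intro L.sup_least) (auto simp: star_def Upper_def)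
    moreover have "\<kappa> (F x) () \<sqsubseteq>\<^bsub>?L\<^esub> \<Squnion>\<^bsub>?L\<^esub> (?f ` Obj B)"
    proof -
      have "Comp Q (Ty A x) (Ty A x) X (\<kappa> (F x) ()) (Ident Q (Ty A x)) \<sqsubseteq>\<^bsub>?L\<^esub> ?f (F x)"
        using tx X cl_x arr[OF Fx] cod.Arr_Ident[OF Fx] dom.Ident_closed[OF tx]
        unfolding tFx by (intro dom.Comp_mono_right) auto
      then have "\<kappa> (F x) () \<sqsubseteq>\<^bsub>?L\<^esub> ?f (F x)"
        using dom.Comp_Ident_right[OF tx X cl_x] by simp
      moreover have "?f (F x) \<sqsubseteq>\<^bsub>?L\<^esub> \<Squnion>\<^bsub>?L\<^esub> (?f ` Obj B)"
        using sub Fx by (intro L.sup_upper) auto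
      ultimately show ?thesis
        by (rule L.le_trans) (use cl_x sub Fx L.sup_closed[OF sub] in auto)
    qed
    ultimately show ?thesis
      using cl_x L.sup_closed[OF sub] by (intro L.le_antisym)
  qed
  then show ?thesis
    using assms map_closed
    by (auto simp: inverse_image_def dist_comp_def graph_def star_def fun_eq_iff restrict_def
        cong: image_cong_simp)
qed

end

theory Submission
  imports Defs
begin

text \<open>
  Both adjunctions are instances of one fact: every distributor \<open>\<phi> : A \<rightarrow> B\<close> induces
  \<open>\<phi>\<^sup>* \<stileturn> \<phi>\<^sub>*\<close> between the presheaf categories (\<open>qadjunction_upper_lower_star\<close>). Indeed
  \<open>\<kappa> \<circ> \<phi> \<le> \<mu>\<close> and \<open>\<kappa> \<le> \<mu> \<swarrow> \<phi>\<close> both say that \<open>\<kappa>(y) \<circ> \<phi>(x,y) \<le> \<mu>(x)\<close> for all \<open>x\<close> and \<open>y\<close>: the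
  first because a join is the least upper bound (\<open>dist_comp_le_iff\<close>), the second because a meet is
  the greatest lower bound and \<open>- \<swarrow> f\<close> is right adjoint to \<open>- \<circ> f\<close> (\<open>le_dist_imp_iff\<close>). The same
  reading of the hom-arrows, \<open>q \<le> PA(\<mu>,\<kappa>)\<close> iff \<open>q \<circ> \<mu>(x) \<le> \<kappa>(x)\<close> for all \<open>x\<close>
  (\<open>le_presheaves_Arr_iff\<close>), turns the \<open>Q\<close>-category axioms of \<open>PA\<close> and the functoriality of
  \<open>\<phi>\<^sup>*\<close> and \<open>\<phi>\<^sub>*\<close> into associativity and monotonicity of composition.

  The fact is applied to the graph and to the cograph of \<open>F\<close>. The inverse image is precomposition
  with the graph, so it is the left adjoint in the adjunction of the graph. It is also the right
  adjoint in the adjunction of the cograph, by the Yoneda lemma: \<open>(\<kappa> \<swarrow> F\<^sup>\<natural>)(x)\<close> is the meet over \<open>y\<close> of \<open>\<kappa>(y) \<swarrow> B(y, F x)\<close>,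
  which is \<open>\<kappa>(F x)\<close> (\<open>dist_imp_cograph\<close>), and \<open>(\<kappa> \<circ> F\<^sub>\<natural>)(x)\<close> is \<open>\<kappa>(F x)\<close> as well.
\<close>

section \<open>Order and residuation in the hom-lattices\<close>

declare (in quantaloid) Comp_closed [simp] Ident_closed [simp] hom_complete_lattice [simp]
declare (in qcategory) Ty_closed [simp] Arr_closed [simp]

context quantaloid
begin

lemma hom_le_refl [simp]:
  assumes "A \<in> Ob Q" "B \<in> Ob Q" "f \<in> carrier (Hom Q A B)"
  shows "f \<sqsubseteq>\<^bsub>Hom Q A B\<^esub> f"
proof -
  interpret L: complete_lattice "Hom Q A B" using assms by simp
  show ?thesis using assms by simp
qed

lemma hom_le_trans:
  assumes "f \<sqsubseteq>\<^bsub>Hom Q A B\<^esub> g" "g \<sqsubseteq>\<^bsub>Hom Q A B\<^esub> h" "A \<in> Ob Q" "B \<in> Ob Q"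
    and "f \<in> carrier (Hom Q A B)" "g \<in> carrier (Hom Q A B)" "h \<in> carrier (Hom Q A B)"
  shows "f \<sqsubseteq>\<^bsub>Hom Q A B\<^esub> h"
proof -
  interpret L: complete_lattice "Hom Q A B" using assms by simp
  show ?thesis using assms by (blast intro: L.le_trans)
qed

lemma hom_le_antisym:
  assumes "f \<sqsubseteq>\<^bsub>Hom Q A B\<^esub> g" "g \<sqsubseteq>\<^bsub>Hom Q A B\<^esub> f" "A \<in> Ob Q" "B \<in> Ob Q"
    and "f \<in> carrier (Hom Q A B)" "g \<in> carrier (Hom Q A B)"
  shows "f = g"
proof -
  interpret L: complete_lattice "Hom Q A B" using assms by simp
  show ?thesis using assms by (blast intro: L.le_antisym)
qed

lemma hom_Sup_closed [simp]:
  assumes "A \<in> Ob Q" "B \<in> Ob Q" "S \<subseteq> carrier (Hom Q A B)"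
  shows "\<Squnion>\<^bsub>Hom Q A B\<^esub> S \<in> carrier (Hom Q A B)"
proof -
  interpret L: complete_lattice "Hom Q A B" using assms by simp
  show ?thesis using assms by simp
qed

lemma hom_Inf_closed [simp]:
  assumes "A \<in> Ob Q" "B \<in> Ob Q" "S \<subseteq> carrier (Hom Q A B)"
  shows "\<Sqinter>\<^bsub>Hom Q A B\<^esub> S \<in> carrier (Hom Q A B)"
proof -
  interpret L: complete_lattice "Hom Q A B" using assms by simp
  show ?thesis using assms by simp
qed

lemma hom_Sup_le_iff:
  assumes "A \<in> Ob Q" "B \<in> Ob Q" "S \<subseteq> carrier (Hom Q A B)" "g \<in> carrier (Hom Q A B)"
  shows "\<Squnion>\<^bsub>Hom Q A B\<^esub> S \<sqsubseteq>\<^bsub>Hom Q A B\<^esub> g \<longleftrightarrow> (\<forall>f\<in>S. f \<sqsubseteq>\<^bsub>Hom Q A B\<^esub> g)"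
proof -
  interpret L: complete_lattice "Hom Q A B" using assms by simp
  show ?thesis
  proof
    assume "\<Squnion>\<^bsub>Hom Q A B\<^esub> S \<sqsubseteq>\<^bsub>Hom Q A B\<^esub> g"
    then show "\<forall>f\<in>S. f \<sqsubseteq>\<^bsub>Hom Q A B\<^esub> g"
      using assms L.sup_upper[of S] by (meson L.le_trans L.sup_closed subsetD)
  next
    assume "\<forall>f\<in>S. f \<sqsubseteq>\<^bsub>Hom Q A B\<^esub> g"
    then show "\<Squnion>\<^bsub>Hom Q A B\<^esub> S \<sqsubseteq>\<^bsub>Hom Q A B\<^esub> g"
      using assms by (intro L.sup_least) (auto simp: Upper_def)
  qed
qed

lemma hom_le_Inf_iff:
  assumes "A \<in> Ob Q" "B \<in> Ob Q" "S \<subseteq> carrier (Hom Q A B)" "g \<in> carrier (Hom Q A B)"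
  shows "g \<sqsubseteq>\<^bsub>Hom Q A B\<^esub> \<Sqinter>\<^bsub>Hom Q A B\<^esub> S \<longleftrightarrow> (\<forall>f\<in>S. g \<sqsubseteq>\<^bsub>Hom Q A B\<^esub> f)"
proof -
  interpret L: complete_lattice "Hom Q A B" using assms by simp
  show ?thesis
  proof
    assume "g \<sqsubseteq>\<^bsub>Hom Q A B\<^esub> \<Sqinter>\<^bsub>Hom Q A B\<^esub> S"
    then show "\<forall>f\<in>S. g \<sqsubseteq>\<^bsub>Hom Q A B\<^esub> f"
      using assms L.inf_lower[of S] by (meson L.le_trans L.inf_closed subsetD)
  next
    assume "\<forall>f\<in>S. g \<sqsubseteq>\<^bsub>Hom Q A B\<^esub> f"
    then show "g \<sqsubseteq>\<^bsub>Hom Q A B\<^esub> \<Sqinter>\<^bsub>Hom Q A B\<^esub> S"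
      using assms by (intro L.inf_greatest) (auto simp: Lower_def)
  qed
qed

text \<open>
  Preservation of the binary join \<open>g \<squnion> g' = g'\<close> gives monotonicity.
\<close>

lemma Comp_mono_left:
  assumes "A \<in> Ob Q" "B \<in> Ob Q" "C \<in> Ob Q" "f \<in> carrier (Hom Q A B)"
    and "g \<in> carrier (Hom Q B C)" "g' \<in> carrier (Hom Q B C)" "g \<sqsubseteq>\<^bsub>Hom Q B C\<^esub> g'"
  shows "Comp Q A B C g f \<sqsubseteq>\<^bsub>Hom Q A C\<^esub> Comp Q A B C g' f"
proof -
  have S: "{g, g'} \<subseteq> carrier (Hom Q B C)" using assms by simp
  have cl: "\<Squnion>\<^bsub>Hom Q B C\<^esub> {g, g'} \<in> carrier (Hom Q B C)"
    using assms by simp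
  have "\<Squnion>\<^bsub>Hom Q B C\<^esub> {g, g'} = g'"
  proof (rule hom_le_antisym)
    show "\<Squnion>\<^bsub>Hom Q B C\<^esub> {g, g'} \<sqsubseteq>\<^bsub>Hom Q B C\<^esub> g'"
      using assms by (simp add: hom_Sup_le_iff)
    show "g' \<sqsubseteq>\<^bsub>Hom Q B C\<^esub> \<Squnion>\<^bsub>Hom Q B C\<^esub> {g, g'}"
      using hom_Sup_le_iff[OF assms(2,3) S cl] cl assms by simp
  qed (use assms cl in auto)
  then have "Comp Q A B C g' f = \<Squnion>\<^bsub>Hom Q A C\<^esub> {Comp Q A B C g f, Comp Q A B C g' f}"
    using Comp_Sup_left[OF assms(1-4) S] by simp
  then show ?thesis
    using hom_Sup_le_iff[of A C "{Comp Q A B C g f, Comp Q A B C g' f}" "Comp Q A B C g' f"] assms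
    by simp
qed

text \<open>
  The join of all \<open>h\<close> with \<open>h \<circ> f \<le> g\<close> is itself such an \<open>h\<close>, because \<open>- \<circ> f\<close> preserves joins;
  so the implication is attained and is right adjoint to \<open>- \<circ> f\<close>.
\<close>

lemma right_imp_residuation:
  assumes "A \<in> Ob Q" "B \<in> Ob Q" "X \<in> Ob Q"
    and "f \<in> carrier (Hom Q A B)" "g \<in> carrier (Hom Q A X)"
  shows right_imp_closed [simp]: "right_imp Q A B X g f \<in> carrier (Hom Q B X)"
    and le_right_imp_iff: "\<And>h. h \<in> carrier (Hom Q B X) \<Longrightarrow>
      h \<sqsubseteq>\<^bsub>Hom Q B X\<^esub> right_imp Q A B X g f \<longleftrightarrow> Comp Q A B X h f \<sqsubseteq>\<^bsub>Hom Q A X\<^esub> g"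
proof -
  let ?S = "{h \<in> carrier (Hom Q B X). Comp Q A B X h f \<sqsubseteq>\<^bsub>Hom Q A X\<^esub> g}"
  let ?j = "\<Squnion>\<^bsub>Hom Q B X\<^esub> ?S"
  have S: "?S \<subseteq> carrier (Hom Q B X)" by auto
  have j: "?j \<in> carrier (Hom Q B X)" using assms S by simp
  have upper: "\<forall>h\<in>?S. h \<sqsubseteq>\<^bsub>Hom Q B X\<^esub> ?j"
    using hom_Sup_le_iff[OF assms(2,3) S j] j assms by simp
  have "Comp Q A B X ?j f = \<Squnion>\<^bsub>Hom Q A X\<^esub> ((\<lambda>h. Comp Q A B X h f) ` ?S)"
    using assms S by (intro Comp_Sup_left)
  also have "\<dots> \<sqsubseteq>\<^bsub>Hom Q A X\<^esub> g"
    using assms by (subst hom_Sup_le_iff) auto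
  finally have mem: "?j \<in> ?S" using j by simp
  have "greatest (Hom Q B X) ?j ?S"
    using S mem upper by (auto simp: greatest_def)
  moreover have "h = ?j" if "greatest (Hom Q B X) h ?S" for h
    using that mem upper assms j by (intro hom_le_antisym[of B X h]) (auto simp: greatest_def)
  ultimately have eq: "right_imp Q A B X g f = ?j"
    unfolding right_imp_def by (blast intro: the_equality)
  show "right_imp Q A B X g f \<in> carrier (Hom Q B X)" using eq j by simp
  fix h assume h: "h \<in> carrier (Hom Q B X)"
  show "h \<sqsubseteq>\<^bsub>Hom Q B X\<^esub> right_imp Q A B X g f \<longleftrightarrow> Comp Q A B X h f \<sqsubseteq>\<^bsub>Hom Q A X\<^esub> g"
  proof
    assume "h \<sqsubseteq>\<^bsub>Hom Q B X\<^esub> right_imp Q A B X g f"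
    then have "Comp Q A B X h f \<sqsubseteq>\<^bsub>Hom Q A X\<^esub> Comp Q A B X ?j f"
      using eq assms h j by (intro Comp_mono_left) auto
    then show "Comp Q A B X h f \<sqsubseteq>\<^bsub>Hom Q A X\<^esub> g"
      by (rule hom_le_trans) (use mem assms h j in auto)
  next
    assume "Comp Q A B X h f \<sqsubseteq>\<^bsub>Hom Q A X\<^esub> g"
    then show "h \<sqsubseteq>\<^bsub>Hom Q B X\<^esub> right_imp Q A B X g f" using eq upper h by simp
  qed
qed

end

section \<open>The calculus of distributors\<close>

lemma (in qdistributor) dist_value [simp]:
  "x \<in> Obj A \<Longrightarrow> y \<in> Obj B \<Longrightarrow> \<phi> x y \<in> carrier (Hom Q (Ty A x) (Ty B y))"
  using dist_closed by (auto simp: PiE_iff)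

text \<open>
  The value of a composite is characterised by what lies above it, also after composing it on
  either side with an arrow of \<open>Q\<close>. These equivalences replace every calculation with joins of
  arrows by a calculation with the single terms \<open>\<psi>(y,z) \<circ> \<phi>(x,y)\<close>.
\<close>

lemma dist_comp_value:
  assumes "qdistributor Q A B \<phi>" "qdistributor Q B C \<psi>" "x \<in> Obj A" "z \<in> Obj C"
  shows dist_comp_closed:
      "dist_comp Q A B C \<psi> \<phi> x z \<in> carrier (Hom Q (Ty A x) (Ty C z))"
    and dist_comp_le_iff: "\<And>h. h \<in> carrier (Hom Q (Ty A x) (Ty C z)) \<Longrightarrow>
      dist_comp Q A B C \<psi> \<phi> x z \<sqsubseteq>\<^bsub>Hom Q (Ty A x) (Ty C z)\<^esub> h \<longleftrightarrow>
      (\<forall>y\<in>Obj B. Comp Q (Ty A x) (Ty B y) (Ty C z) (\<psi> y z) (\<phi> x y)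
        \<sqsubseteq>\<^bsub>Hom Q (Ty A x) (Ty C z)\<^esub> h)"
    and Comp_dist_comp_le_iff: "\<And>D g h. D \<in> Ob Q \<Longrightarrow> g \<in> carrier (Hom Q (Ty C z) D) \<Longrightarrow>
      h \<in> carrier (Hom Q (Ty A x) D) \<Longrightarrow>
      Comp Q (Ty A x) (Ty C z) D g (dist_comp Q A B C \<psi> \<phi> x z) \<sqsubseteq>\<^bsub>Hom Q (Ty A x) D\<^esub> h \<longleftrightarrow>
      (\<forall>y\<in>Obj B. Comp Q (Ty A x) (Ty C z) D g (Comp Q (Ty A x) (Ty B y) (Ty C z) (\<psi> y z) (\<phi> x y))
        \<sqsubseteq>\<^bsub>Hom Q (Ty A x) D\<^esub> h)"
    and dist_comp_Comp_le_iff: "\<And>D f h. D \<in> Ob Q \<Longrightarrow> f \<in> carrier (Hom Q D (Ty A x)) \<Longrightarrow>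
      h \<in> carrier (Hom Q D (Ty C z)) \<Longrightarrow>
      Comp Q D (Ty A x) (Ty C z) (dist_comp Q A B C \<psi> \<phi> x z) f \<sqsubseteq>\<^bsub>Hom Q D (Ty C z)\<^esub> h \<longleftrightarrow>
      (\<forall>y\<in>Obj B. Comp Q D (Ty A x) (Ty C z) (Comp Q (Ty A x) (Ty B y) (Ty C z) (\<psi> y z) (\<phi> x y)) f
        \<sqsubseteq>\<^bsub>Hom Q D (Ty C z)\<^esub> h)"
proof -
  interpret \<phi>: qdistributor Q A B \<phi> by fact
  interpret \<psi>: qdistributor Q B C \<psi> by fact
  let ?S = "(\<lambda>y. Comp Q (Ty A x) (Ty B y) (Ty C z) (\<psi> y z) (\<phi> x y)) ` Obj B"
  have S: "?S \<subseteq> carrier (Hom Q (Ty A x) (Ty C z))" using assms by auto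
  have eq: "dist_comp Q A B C \<psi> \<phi> x z = \<Squnion>\<^bsub>Hom Q (Ty A x) (Ty C z)\<^esub> ?S"
    using assms by (simp add: dist_comp_def)
  show "dist_comp Q A B C \<psi> \<phi> x z \<in> carrier (Hom Q (Ty A x) (Ty C z))"
    unfolding eq using S assms by simp
  show "dist_comp Q A B C \<psi> \<phi> x z \<sqsubseteq>\<^bsub>Hom Q (Ty A x) (Ty C z)\<^esub> h \<longleftrightarrow>
      (\<forall>y\<in>Obj B. Comp Q (Ty A x) (Ty B y) (Ty C z) (\<psi> y z) (\<phi> x y)
        \<sqsubseteq>\<^bsub>Hom Q (Ty A x) (Ty C z)\<^esub> h)"
    if "h \<in> carrier (Hom Q (Ty A x) (Ty C z))" for h
    unfolding eq using S that assms by (subst \<phi>.dom.hom_Sup_le_iff) auto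
  show "Comp Q (Ty A x) (Ty C z) D g (dist_comp Q A B C \<psi> \<phi> x z) \<sqsubseteq>\<^bsub>Hom Q (Ty A x) D\<^esub> h \<longleftrightarrow>
      (\<forall>y\<in>Obj B. Comp Q (Ty A x) (Ty C z) D g (Comp Q (Ty A x) (Ty B y) (Ty C z) (\<psi> y z) (\<phi> x y))
        \<sqsubseteq>\<^bsub>Hom Q (Ty A x) D\<^esub> h)"
    if "D \<in> Ob Q" "g \<in> carrier (Hom Q (Ty C z) D)" "h \<in> carrier (Hom Q (Ty A x) D)" for D g h
    unfolding eq using S that assms
    by (subst \<phi>.dom.Comp_Sup_right, simp_all, subst \<phi>.dom.hom_Sup_le_iff) auto
  show "Comp Q D (Ty A x) (Ty C z) (dist_comp Q A B C \<psi> \<phi> x z) f \<sqsubseteq>\<^bsub>Hom Q D (Ty C z)\<^esub> h \<longleftrightarrow>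
      (\<forall>y\<in>Obj B. Comp Q D (Ty A x) (Ty C z) (Comp Q (Ty A x) (Ty B y) (Ty C z) (\<psi> y z) (\<phi> x y)) f
        \<sqsubseteq>\<^bsub>Hom Q D (Ty C z)\<^esub> h)"
    if "D \<in> Ob Q" "f \<in> carrier (Hom Q D (Ty A x))" "h \<in> carrier (Hom Q D (Ty C z))" for D f h
    unfolding eq using S that assms
    by (subst \<phi>.dom.Comp_Sup_left, simp_all, subst \<phi>.dom.hom_Sup_le_iff) auto
qed

text \<open>
  Dually, an implication is characterised by what lies below it; over an empty \<open>A\<close> it is the top
  element and the condition is vacuous.
\<close>

lemma dist_imp_value:
  assumes "qdistributor Q A B \<phi>" "qdistributor Q A C \<eta>" "y \<in> Obj B" "z \<in> Obj C"
  shows dist_imp_closed: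
      "dist_imp Q A B C \<eta> \<phi> y z \<in> carrier (Hom Q (Ty B y) (Ty C z))"
    and le_dist_imp_iff: "\<And>h. h \<in> carrier (Hom Q (Ty B y) (Ty C z)) \<Longrightarrow>
      h \<sqsubseteq>\<^bsub>Hom Q (Ty B y) (Ty C z)\<^esub> dist_imp Q A B C \<eta> \<phi> y z \<longleftrightarrow>
      (\<forall>x\<in>Obj A. Comp Q (Ty A x) (Ty B y) (Ty C z) h (\<phi> x y)
        \<sqsubseteq>\<^bsub>Hom Q (Ty A x) (Ty C z)\<^esub> \<eta> x z)"
proof -
  interpret \<phi>: qdistributor Q A B \<phi> by fact
  interpret \<eta>: qdistributor Q A C \<eta> by fact
  let ?S = "(\<lambda>x. right_imp Q (Ty A x) (Ty B y) (Ty C z) (\<eta> x z) (\<phi> x y)) ` Obj A"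
  have S: "?S \<subseteq> carrier (Hom Q (Ty B y) (Ty C z))" using assms by auto
  have eq: "dist_imp Q A B C \<eta> \<phi> y z = \<Sqinter>\<^bsub>Hom Q (Ty B y) (Ty C z)\<^esub> ?S"
    using assms by (simp add: dist_imp_def)
  show "dist_imp Q A B C \<eta> \<phi> y z \<in> carrier (Hom Q (Ty B y) (Ty C z))"
    unfolding eq using S assms by simp
  show "h \<sqsubseteq>\<^bsub>Hom Q (Ty B y) (Ty C z)\<^esub> dist_imp Q A B C \<eta> \<phi> y z \<longleftrightarrow>
      (\<forall>x\<in>Obj A. Comp Q (Ty A x) (Ty B y) (Ty C z) h (\<phi> x y)
        \<sqsubseteq>\<^bsub>Hom Q (Ty A x) (Ty C z)\<^esub> \<eta> x z)"
    if "h \<in> carrier (Hom Q (Ty B y) (Ty C z))" for h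
    unfolding eq using S that assms
    by (subst \<phi>.dom.hom_le_Inf_iff) (auto simp: \<phi>.dom.le_right_imp_iff)
qed

lemma le_dist_comp:
  assumes "qdistributor Q A B \<phi>" "qdistributor Q B C \<psi>" "x \<in> Obj A" "y \<in> Obj B" "z \<in> Obj C"
  shows "Comp Q (Ty A x) (Ty B y) (Ty C z) (\<psi> y z) (\<phi> x y)
    \<sqsubseteq>\<^bsub>Hom Q (Ty A x) (Ty C z)\<^esub> dist_comp Q A B C \<psi> \<phi> x z"
proof -
  interpret \<phi>: qdistributor Q A B \<phi> by fact
  interpret \<psi>: qdistributor Q B C \<psi> by fact
  show ?thesis
    using dist_comp_le_iff[OF assms(1-3,5) dist_comp_closed[OF assms(1-3,5)]]
      dist_comp_closed[OF assms(1-3,5)] assms by simp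
qed

lemma dist_imp_Comp_le:
  assumes "qdistributor Q A B \<phi>" "qdistributor Q A C \<eta>" "x \<in> Obj A" "y \<in> Obj B" "z \<in> Obj C"
  shows "Comp Q (Ty A x) (Ty B y) (Ty C z) (dist_imp Q A B C \<eta> \<phi> y z) (\<phi> x y)
    \<sqsubseteq>\<^bsub>Hom Q (Ty A x) (Ty C z)\<^esub> \<eta> x z"
proof -
  interpret \<phi>: qdistributor Q A B \<phi> by fact
  interpret \<eta>: qdistributor Q A C \<eta> by fact
  show ?thesis
    using le_dist_imp_iff[OF assms(1,2,4,5) dist_imp_closed[OF assms(1,2,4,5)]]
      dist_imp_closed[OF assms(1,2,4,5)] assms by simp
qed

text \<open>
  An arrow of \<open>C\<close> is absorbed by \<open>\<psi>\<close> and an arrow of \<open>A\<close> by \<open>\<phi>\<close>, in each term of the join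
  separately.
\<close>

lemma qdistributor_dist_comp:
  assumes "qdistributor Q A B \<phi>" "qdistributor Q B C \<psi>"
  shows "qdistributor Q A C (dist_comp Q A B C \<psi> \<phi>)"
proof -
  interpret \<phi>: qdistributor Q A B \<phi> by fact
  interpret \<psi>: qdistributor Q B C \<psi> by fact
  note [simp] = dist_comp_closed[OF assms]
  show ?thesis
  proof
    show "dist_comp Q A B C \<psi> \<phi> \<in> (\<Pi>\<^sub>E x\<in>Obj A. \<Pi>\<^sub>E z\<in>Obj C. carrier (Hom Q (Ty A x) (Ty C z)))"
      using dist_comp_closed[OF assms] by (auto simp: PiE_iff dist_comp_def extensional_def)
  next
    fix x z' z assume [simp]: "x \<in> Obj A" "z' \<in> Obj C" "z \<in> Obj C"
    have "Comp Q (Ty A x) (Ty C z') (Ty C z) (Arr C z' z)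
          (Comp Q (Ty A x) (Ty B y) (Ty C z') (\<psi> y z') (\<phi> x y))
        \<sqsubseteq>\<^bsub>Hom Q (Ty A x) (Ty C z)\<^esub> dist_comp Q A B C \<psi> \<phi> x z" if [simp]: "y \<in> Obj B" for y
    proof (rule \<phi>.dom.hom_le_trans)
      show "Comp Q (Ty A x) (Ty C z') (Ty C z) (Arr C z' z)
            (Comp Q (Ty A x) (Ty B y) (Ty C z') (\<psi> y z') (\<phi> x y))
          \<sqsubseteq>\<^bsub>Hom Q (Ty A x) (Ty C z)\<^esub> Comp Q (Ty A x) (Ty B y) (Ty C z) (\<psi> y z) (\<phi> x y)"
        by (simp add: \<phi>.dom.Comp_assoc \<phi>.dom.Comp_mono_left \<psi>.dist_cod)
    qed (use assms in \<open>auto intro: le_dist_comp\<close>)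
    then show "Comp Q (Ty A x) (Ty C z') (Ty C z) (Arr C z' z) (dist_comp Q A B C \<psi> \<phi> x z')
        \<sqsubseteq>\<^bsub>Hom Q (Ty A x) (Ty C z)\<^esub> dist_comp Q A B C \<psi> \<phi> x z"
      by (simp add: Comp_dist_comp_le_iff[OF assms])
  next
    fix x x' z assume [simp]: "x \<in> Obj A" "x' \<in> Obj A" "z \<in> Obj C"
    have "Comp Q (Ty A x) (Ty A x') (Ty C z)
          (Comp Q (Ty A x') (Ty B y) (Ty C z) (\<psi> y z) (\<phi> x' y)) (Arr A x x')
        \<sqsubseteq>\<^bsub>Hom Q (Ty A x) (Ty C z)\<^esub> dist_comp Q A B C \<psi> \<phi> x z" if [simp]: "y \<in> Obj B" for y
    proof (rule \<phi>.dom.hom_le_trans)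
      show "Comp Q (Ty A x) (Ty A x') (Ty C z)
            (Comp Q (Ty A x') (Ty B y) (Ty C z) (\<psi> y z) (\<phi> x' y)) (Arr A x x')
          \<sqsubseteq>\<^bsub>Hom Q (Ty A x) (Ty C z)\<^esub> Comp Q (Ty A x) (Ty B y) (Ty C z) (\<psi> y z) (\<phi> x y)"
        by (simp flip: \<phi>.dom.Comp_assoc add: \<phi>.dom.Comp_mono_right \<phi>.dist_dom)
    qed (use assms in \<open>auto intro: le_dist_comp\<close>)
    then show "Comp Q (Ty A x) (Ty A x') (Ty C z) (dist_comp Q A B C \<psi> \<phi> x' z) (Arr A x x')
        \<sqsubseteq>\<^bsub>Hom Q (Ty A x) (Ty C z)\<^esub> dist_comp Q A B C \<psi> \<phi> x z"
      by (simp add: dist_comp_Comp_le_iff[OF assms])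
  qed
qed

text \<open>
  After transposing along \<open>- \<circ> \<phi>(x,y)\<close>, an arrow of \<open>C\<close> is absorbed by \<open>\<eta>\<close> and an arrow of \<open>B\<close> by
  \<open>\<phi>\<close>; this exchange of sides is why \<open>\<eta> \<swarrow> \<phi>\<close> goes from \<open>B\<close> to \<open>C\<close>.
\<close>

lemma qdistributor_dist_imp:
  assumes "qdistributor Q A B \<phi>" "qdistributor Q A C \<eta>"
  shows "qdistributor Q B C (dist_imp Q A B C \<eta> \<phi>)"
proof -
  interpret \<phi>: qdistributor Q A B \<phi> by fact
  interpret \<eta>: qdistributor Q A C \<eta> by fact
  note [simp] = dist_imp_closed[OF assms]
  let ?i = "dist_imp Q A B C \<eta> \<phi>"
  show ?thesis
  proof
    show "?i \<in> (\<Pi>\<^sub>E y\<in>Obj B. \<Pi>\<^sub>E z\<in>Obj C. carrier (Hom Q (Ty B y) (Ty C z)))"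
      using dist_imp_closed[OF assms] by (auto simp: PiE_iff dist_imp_def extensional_def)
  next
    fix y z' z assume [simp]: "y \<in> Obj B" "z' \<in> Obj C" "z \<in> Obj C"
    have "Comp Q (Ty A x) (Ty B y) (Ty C z)
          (Comp Q (Ty B y) (Ty C z') (Ty C z) (Arr C z' z) (?i y z')) (\<phi> x y)
        \<sqsubseteq>\<^bsub>Hom Q (Ty A x) (Ty C z)\<^esub> \<eta> x z" if [simp]: "x \<in> Obj A" for x
    proof (rule \<phi>.dom.hom_le_trans)
      show "Comp Q (Ty A x) (Ty B y) (Ty C z)
            (Comp Q (Ty B y) (Ty C z') (Ty C z) (Arr C z' z) (?i y z')) (\<phi> x y)
          \<sqsubseteq>\<^bsub>Hom Q (Ty A x) (Ty C z)\<^esub> Comp Q (Ty A x) (Ty C z') (Ty C z) (Arr C z' z) (\<eta> x z')"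
        by (simp flip: \<phi>.dom.Comp_assoc add: \<phi>.dom.Comp_mono_right dist_imp_Comp_le[OF assms])
    qed (auto intro: \<eta>.dist_cod)
    then show "Comp Q (Ty B y) (Ty C z') (Ty C z) (Arr C z' z) (?i y z')
        \<sqsubseteq>\<^bsub>Hom Q (Ty B y) (Ty C z)\<^esub> ?i y z"
      by (simp add: le_dist_imp_iff[OF assms])
  next
    fix y y' z assume [simp]: "y \<in> Obj B" "y' \<in> Obj B" "z \<in> Obj C"
    have "Comp Q (Ty A x) (Ty B y) (Ty C z)
          (Comp Q (Ty B y) (Ty B y') (Ty C z) (?i y' z) (Arr B y y')) (\<phi> x y)
        \<sqsubseteq>\<^bsub>Hom Q (Ty A x) (Ty C z)\<^esub> \<eta> x z" if [simp]: "x \<in> Obj A" for x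
    proof (rule \<phi>.dom.hom_le_trans)
      show "Comp Q (Ty A x) (Ty B y) (Ty C z)
            (Comp Q (Ty B y) (Ty B y') (Ty C z) (?i y' z) (Arr B y y')) (\<phi> x y)
          \<sqsubseteq>\<^bsub>Hom Q (Ty A x) (Ty C z)\<^esub> Comp Q (Ty A x) (Ty B y') (Ty C z) (?i y' z) (\<phi> x y')"
        by (simp flip: \<phi>.dom.Comp_assoc add: \<phi>.dom.Comp_mono_right \<phi>.dist_cod)
    qed (use assms in \<open>auto intro: dist_imp_Comp_le\<close>)
    then show "Comp Q (Ty B y) (Ty B y') (Ty C z) (?i y' z) (Arr B y y')
        \<sqsubseteq>\<^bsub>Hom Q (Ty B y) (Ty C z)\<^esub> ?i y z"
      by (simp add: le_dist_imp_iff[OF assms])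
  qed
qed

context qfunctor
begin

text \<open>
  The types \<open>Ty B (F x)\<close> and \<open>Ty A x\<close> agree; the closure rules for hom-arrows of \<open>B\<close> at \<open>F x\<close> are
  stated over \<open>Ty A x\<close>, the type occurring in the graph and in the cograph.
\<close>

lemma map_mem [simp]: "x \<in> Obj A \<Longrightarrow> F x \<in> Obj B"
  using map_closed by auto

lemma Arr_map_left_closed [simp]:
  "x \<in> Obj A \<Longrightarrow> y \<in> Obj B \<Longrightarrow> Arr B (F x) y \<in> carrier (Hom Q (Ty A x) (Ty B y))"
  using cod.Arr_closed[of "F x" y] by (simp add: map_Ty)

lemma Arr_map_right_closed [simp]:
  "x \<in> Obj A \<Longrightarrow> y \<in> Obj B \<Longrightarrow> Arr B y (F x) \<in> carrier (Hom Q (Ty B y) (Ty A x))"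
  using cod.Arr_closed[of y "F x"] by (simp add: map_Ty)

lemma Arr_map_closed [simp]:
  "x \<in> Obj A \<Longrightarrow> x' \<in> Obj A \<Longrightarrow> Arr B (F x) (F x') \<in> carrier (Hom Q (Ty A x) (Ty A x'))"
  using cod.Arr_closed[of "F x" "F x'"] by (simp add: map_Ty)

lemma qdistributor_graph: "qdistributor Q A B (graph A B F)"
proof
  show "graph A B F \<in> (\<Pi>\<^sub>E x\<in>Obj A. \<Pi>\<^sub>E y\<in>Obj B. carrier (Hom Q (Ty A x) (Ty B y)))"
    by (auto simp: graph_def)
next
  fix x y' y assume "x \<in> Obj A" "y' \<in> Obj B" "y \<in> Obj B"
  then show "Comp Q (Ty A x) (Ty B y') (Ty B y) (Arr B y' y) (graph A B F x y')
      \<sqsubseteq>\<^bsub>Hom Q (Ty A x) (Ty B y)\<^esub> graph A B F x y"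
    using cod.Arr_Comp[of "F x" y' y] by (simp add: graph_def map_Ty)
next
  fix x x' y assume [simp]: "x \<in> Obj A" "x' \<in> Obj A" "y \<in> Obj B"
  have "Comp Q (Ty A x) (Ty A x') (Ty B y) (Arr B (F x') y) (Arr A x x')
      \<sqsubseteq>\<^bsub>Hom Q (Ty A x) (Ty B y)\<^esub> Arr B (F x) y"
  proof (rule dom.hom_le_trans)
    show "Comp Q (Ty A x) (Ty A x') (Ty B y) (Arr B (F x') y) (Arr A x x')
        \<sqsubseteq>\<^bsub>Hom Q (Ty A x) (Ty B y)\<^esub>
        Comp Q (Ty A x) (Ty A x') (Ty B y) (Arr B (F x') y) (Arr B (F x) (F x'))"
      by (simp add: dom.Comp_mono_right map_Arr)
  qed (use cod.Arr_Comp[of "F x" "F x'" y] in \<open>simp_all add: map_Ty\<close>)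
  then show "Comp Q (Ty A x) (Ty A x') (Ty B y) (graph A B F x' y) (Arr A x x')
      \<sqsubseteq>\<^bsub>Hom Q (Ty A x) (Ty B y)\<^esub> graph A B F x y"
    by (simp add: graph_def)
qed

lemma qdistributor_cograph: "qdistributor Q B A (cograph A B F)"
proof
  show "cograph A B F \<in> (\<Pi>\<^sub>E y\<in>Obj B. \<Pi>\<^sub>E x\<in>Obj A. carrier (Hom Q (Ty B y) (Ty A x)))"
    by (auto simp: cograph_def)
next
  fix y x' x assume [simp]: "y \<in> Obj B" "x' \<in> Obj A" "x \<in> Obj A"
  have "Comp Q (Ty B y) (Ty A x') (Ty A x) (Arr A x' x) (Arr B y (F x'))
      \<sqsubseteq>\<^bsub>Hom Q (Ty B y) (Ty A x)\<^esub> Arr B y (F x)"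
  proof (rule dom.hom_le_trans)
    show "Comp Q (Ty B y) (Ty A x') (Ty A x) (Arr A x' x) (Arr B y (F x'))
        \<sqsubseteq>\<^bsub>Hom Q (Ty B y) (Ty A x)\<^esub>
        Comp Q (Ty B y) (Ty A x') (Ty A x) (Arr B (F x') (F x)) (Arr B y (F x'))"
      by (simp add: dom.Comp_mono_left map_Arr)
  qed (use cod.Arr_Comp[of y "F x'" "F x"] in \<open>simp_all add: map_Ty\<close>)
  then show "Comp Q (Ty B y) (Ty A x') (Ty A x) (Arr A x' x) (cograph A B F y x')
      \<sqsubseteq>\<^bsub>Hom Q (Ty B y) (Ty A x)\<^esub> cograph A B F y x"
    by (simp add: cograph_def)
next
  fix y y' x assume "y \<in> Obj B" "y' \<in> Obj B" "x \<in> Obj A"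
  then show "Comp Q (Ty B y) (Ty B y') (Ty A x) (cograph A B F y' x) (Arr B y y')
      \<sqsubseteq>\<^bsub>Hom Q (Ty B y) (Ty A x)\<^esub> cograph A B F y x"
    using cod.Arr_Comp[of y y' "F x"] by (simp add: cograph_def map_Ty)
qed

end

section \<open>Presheaf categories\<close>

lemma star_simps [simp]:
  "Obj (star Q X) = {()}" "Ty (star Q X) u = X" "Arr (star Q X) u v = Ident Q X"
  by (simp_all add: star_def)

lemma presheaves_simps [simp]:
  "(X, \<mu>) \<in> Obj (presheaves Q A) \<longleftrightarrow> X \<in> Ob Q \<and> qdistributor Q A (star Q X) \<mu>"
  "Ty (presheaves Q A) (X, \<mu>) = X"
  "Arr (presheaves Q A) (X, \<mu>) (Y, \<kappa>) = dist_imp Q A (star Q X) (star Q Y) \<kappa> \<mu> () ()"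
  by (simp_all add: presheaves_def)

lemma presheaf_closed:
  assumes "qdistributor Q A (star Q X) \<mu>" "x \<in> Obj A"
  shows "\<mu> x () \<in> carrier (Hom Q (Ty A x) X)"
proof -
  interpret qdistributor Q A "star Q X" \<mu> by fact
  show ?thesis using dist_value[of x "()"] assms by simp
qed

lemma presheaves_Arr_closed:
  assumes "qdistributor Q A (star Q X) \<mu>" "qdistributor Q A (star Q Y) \<kappa>"
  shows "dist_imp Q A (star Q X) (star Q Y) \<kappa> \<mu> () () \<in> carrier (Hom Q X Y)"
  using dist_imp_closed[OF assms, of "()" "()"] by simp

text \<open>
  The universal property of the hom-arrow \<open>PA(\<mu>,\<kappa>)\<close>, from which its \<open>Q\<close>-category axioms and the
  functoriality of \<open>\<phi>\<^sup>*\<close> and \<open>\<phi>\<^sub>*\<close> follow.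
\<close>

lemma le_presheaves_Arr_iff:
  assumes "qdistributor Q A (star Q X) \<mu>" "qdistributor Q A (star Q Y) \<kappa>"
    and "q \<in> carrier (Hom Q X Y)"
  shows "q \<sqsubseteq>\<^bsub>Hom Q X Y\<^esub> dist_imp Q A (star Q X) (star Q Y) \<kappa> \<mu> () () \<longleftrightarrow>
    (\<forall>x\<in>Obj A. Comp Q (Ty A x) X Y q (\<mu> x ()) \<sqsubseteq>\<^bsub>Hom Q (Ty A x) Y\<^esub> \<kappa> x ())"
  using le_dist_imp_iff[OF assms(1,2), of "()" "()" q] assms by simp

lemma presheaves_Arr_Comp_le:
  assumes "qdistributor Q A (star Q X) \<mu>" "qdistributor Q A (star Q Y) \<kappa>" "x \<in> Obj A"
  shows "Comp Q (Ty A x) X Y (dist_imp Q A (star Q X) (star Q Y) \<kappa> \<mu> () ()) (\<mu> x ())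
    \<sqsubseteq>\<^bsub>Hom Q (Ty A x) Y\<^esub> \<kappa> x ()"
  using dist_imp_Comp_le[OF assms, of "()" "()"] by simp

lemma (in qcategory) qcategory_presheaves: "qcategory Q (presheaves Q A)"
proof
  fix p assume "p \<in> Obj (presheaves Q A)"
  then show "Ty (presheaves Q A) p \<in> Ob Q" by (cases p) simp
next
  fix p p' assume "p \<in> Obj (presheaves Q A)" "p' \<in> Obj (presheaves Q A)"
  then show "Arr (presheaves Q A) p p'
      \<in> carrier (Hom Q (Ty (presheaves Q A) p) (Ty (presheaves Q A) p'))"
    by (cases p; cases p') (simp add: presheaves_Arr_closed)
next
  fix p assume "p \<in> Obj (presheaves Q A)"
  then show "Ident Q (Ty (presheaves Q A) p)
      \<sqsubseteq>\<^bsub>Hom Q (Ty (presheaves Q A) p) (Ty (presheaves Q A) p)\<^esub> Arr (presheaves Q A) p p"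
    by (cases p) (simp add: le_presheaves_Arr_iff presheaf_closed Comp_Ident_left)
next
  fix p1 p2 p3
  assume "p1 \<in> Obj (presheaves Q A)" "p2 \<in> Obj (presheaves Q A)" "p3 \<in> Obj (presheaves Q A)"
  moreover obtain X \<mu> Y \<kappa> Z \<nu> where [simp]: "p1 = (X, \<mu>)" "p2 = (Y, \<kappa>)" "p3 = (Z, \<nu>)"
    by (metis surj_pair)
  ultimately have [simp]: "X \<in> Ob Q" "Y \<in> Ob Q" "Z \<in> Ob Q"
    and d: "qdistributor Q A (star Q X) \<mu>" "qdistributor Q A (star Q Y) \<kappa>"
      "qdistributor Q A (star Q Z) \<nu>"
    by auto
  note [simp] = presheaf_closed[OF d(1)] presheaf_closed[OF d(2)] presheaf_closed[OF d(3)]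
    presheaves_Arr_closed[OF d(1,2)] presheaves_Arr_closed[OF d(2,3)]
    presheaves_Arr_closed[OF d(1,3)]
  let ?f = "dist_imp Q A (star Q X) (star Q Y) \<kappa> \<mu> () ()"
  let ?g = "dist_imp Q A (star Q Y) (star Q Z) \<nu> \<kappa> () ()"
  have "Comp Q (Ty A x) X Z (Comp Q X Y Z ?g ?f) (\<mu> x ()) \<sqsubseteq>\<^bsub>Hom Q (Ty A x) Z\<^esub> \<nu> x ()"
    if [simp]: "x \<in> Obj A" for x
  proof (rule hom_le_trans)
    show "Comp Q (Ty A x) X Z (Comp Q X Y Z ?g ?f) (\<mu> x ())
        \<sqsubseteq>\<^bsub>Hom Q (Ty A x) Z\<^esub> Comp Q (Ty A x) Y Z ?g (\<kappa> x ())"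
      by (simp flip: Comp_assoc add: Comp_mono_right presheaves_Arr_Comp_le[OF d(1,2)])
  qed (simp_all add: presheaves_Arr_Comp_le[OF d(2,3)])
  then show "Comp Q (Ty (presheaves Q A) p1) (Ty (presheaves Q A) p2) (Ty (presheaves Q A) p3)
      (Arr (presheaves Q A) p2 p3) (Arr (presheaves Q A) p1 p2)
      \<sqsubseteq>\<^bsub>Hom Q (Ty (presheaves Q A) p1) (Ty (presheaves Q A) p3)\<^esub> Arr (presheaves Q A) p1 p3"
    by (simp add: le_presheaves_Arr_iff[OF d(1,3)])
qed

text \<open>
  Taking \<open>q\<close> to be the identity in the universal property shows that presheaves of equal type are
  compared pointwise; the unit and counit of the adjunctions are checked in this form.
\<close>

lemma underlying_le_presheaves_iff:
  assumes "qdistributor Q A (star Q X) \<mu>" "qdistributor Q A (star Q X) \<kappa>" "X \<in> Ob Q"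
  shows "underlying_le Q (presheaves Q A) (X, \<mu>) (X, \<kappa>) \<longleftrightarrow>
    (\<forall>x\<in>Obj A. \<mu> x () \<sqsubseteq>\<^bsub>Hom Q (Ty A x) X\<^esub> \<kappa> x ())"
proof -
  interpret \<mu>: qdistributor Q A "star Q X" \<mu> by fact
  show ?thesis
    using assms by (simp add: underlying_le_def le_presheaves_Arr_iff presheaf_closed
        \<mu>.dom.Comp_Ident_left)
qed

section \<open>The adjunction induced by a distributor\<close>

context qdistributor
begin

lemma upper_star_apply:
  "(X, \<kappa>) \<in> Obj (presheaves Q B) \<Longrightarrow>
    upper_star Q A B \<phi> (X, \<kappa>) = (X, dist_comp Q A B (star Q X) \<kappa> \<phi>)"
  by (simp add: upper_star_def)

lemma lower_star_apply:
  "(X, \<mu>) \<in> Obj (presheaves Q A) \<Longrightarrow>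
    lower_star Q A B \<phi> (X, \<mu>) = (X, dist_imp Q A B (star Q X) \<mu> \<phi>)"
  by (simp add: lower_star_def)

text \<open>
  If \<open>q \<circ> \<mu> \<le> \<kappa>\<close> pointwise, then \<open>q \<circ> (\<mu> \<circ> \<phi>) = (q \<circ> \<mu>) \<circ> \<phi> \<le> \<kappa> \<circ> \<phi>\<close>; with \<open>q = PB(\<mu>,\<kappa>)\<close> this is
  functoriality.
\<close>

lemma qfunctor_upper_star: "qfunctor Q (presheaves Q B) (presheaves Q A) (upper_star Q A B \<phi>)"
proof -
  interpret PA: qcategory Q "presheaves Q A" by (rule dom.qcategory_presheaves)
  interpret PB: qcategory Q "presheaves Q B" by (rule cod.qcategory_presheaves)
  note dist = qdistributor_axioms
  show ?thesis
  proof
    show "upper_star Q A B \<phi> \<in> Obj (presheaves Q B) \<rightarrow>\<^sub>E Obj (presheaves Q A)"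
      by (auto simp: upper_star_def intro!: qdistributor_dist_comp[OF dist])
  next
    fix p assume "p \<in> Obj (presheaves Q B)"
    then show "Ty (presheaves Q A) (upper_star Q A B \<phi> p) = Ty (presheaves Q B) p"
      by (cases p) (simp add: upper_star_apply)
  next
    fix p p' assume pp': "p \<in> Obj (presheaves Q B)" "p' \<in> Obj (presheaves Q B)"
    obtain X \<mu> Y \<kappa> where [simp]: "p = (X, \<mu>)" "p' = (Y, \<kappa>)" by (metis surj_pair)
    have [simp]: "X \<in> Ob Q" "Y \<in> Ob Q"
      and d [simp]: "qdistributor Q B (star Q X) \<mu>" "qdistributor Q B (star Q Y) \<kappa>"
      using pp' by auto
    note c = qdistributor_dist_comp[OF dist d(1)] qdistributor_dist_comp[OF dist d(2)]
    note [simp] = presheaf_closed[OF d(1)] presheaf_closed[OF d(2)] presheaves_Arr_closed[OF d]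
      presheaf_closed[OF c(1)] presheaf_closed[OF c(2)] presheaves_Arr_closed[OF c]
    let ?q = "dist_imp Q B (star Q X) (star Q Y) \<kappa> \<mu> () ()"
    have "Comp Q (Ty A x) X Y ?q (dist_comp Q A B (star Q X) \<mu> \<phi> x ())
        \<sqsubseteq>\<^bsub>Hom Q (Ty A x) Y\<^esub> dist_comp Q A B (star Q Y) \<kappa> \<phi> x ()" (is "_ \<sqsubseteq>\<^bsub>_\<^esub> ?r")
      if [simp]: "x \<in> Obj A" for x
    proof -
      have "Comp Q (Ty A x) X Y ?q (Comp Q (Ty A x) (Ty B y) X (\<mu> y ()) (\<phi> x y))
          \<sqsubseteq>\<^bsub>Hom Q (Ty A x) Y\<^esub> ?r" if [simp]: "y \<in> Obj B" for y
      proof (rule dom.hom_le_trans)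
        show "Comp Q (Ty A x) X Y ?q (Comp Q (Ty A x) (Ty B y) X (\<mu> y ()) (\<phi> x y))
            \<sqsubseteq>\<^bsub>Hom Q (Ty A x) Y\<^esub> Comp Q (Ty A x) (Ty B y) Y (\<kappa> y ()) (\<phi> x y)"
          by (simp add: dom.Comp_assoc dom.Comp_mono_left presheaves_Arr_Comp_le)
        show "Comp Q (Ty A x) (Ty B y) Y (\<kappa> y ()) (\<phi> x y) \<sqsubseteq>\<^bsub>Hom Q (Ty A x) Y\<^esub> ?r"
          using le_dist_comp[OF dist d(2), of x y "()"] by simp
      qed simp_all
      then show ?thesis
        using Comp_dist_comp_le_iff[OF dist d(1), of x "()" Y ?q ?r] by simp
    qed
    then show "Arr (presheaves Q B) p p'
        \<sqsubseteq>\<^bsub>Hom Q (Ty (presheaves Q B) p) (Ty (presheaves Q B) p')\<^esub>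
        Arr (presheaves Q A) (upper_star Q A B \<phi> p) (upper_star Q A B \<phi> p')"
      by (simp add: upper_star_apply le_presheaves_Arr_iff[OF c])
  qed
qed

text \<open>
  If \<open>q \<circ> \<mu> \<le> \<kappa>\<close> pointwise, then \<open>(q \<circ> (\<mu> \<swarrow> \<phi>)) \<circ> \<phi> \<le> q \<circ> \<mu> \<le> \<kappa>\<close>, so \<open>q \<circ> (\<mu> \<swarrow> \<phi>) \<le> \<kappa> \<swarrow> \<phi>\<close>;
  with \<open>q = PA(\<mu>,\<kappa>)\<close> this is functoriality.
\<close>

lemma qfunctor_lower_star: "qfunctor Q (presheaves Q A) (presheaves Q B) (lower_star Q A B \<phi>)"
proof -
  interpret PA: qcategory Q "presheaves Q A" by (rule dom.qcategory_presheaves)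
  interpret PB: qcategory Q "presheaves Q B" by (rule cod.qcategory_presheaves)
  note dist = qdistributor_axioms
  show ?thesis
  proof
    show "lower_star Q A B \<phi> \<in> Obj (presheaves Q A) \<rightarrow>\<^sub>E Obj (presheaves Q B)"
      by (auto simp: lower_star_def intro!: qdistributor_dist_imp[OF dist])
  next
    fix p assume "p \<in> Obj (presheaves Q A)"
    then show "Ty (presheaves Q B) (lower_star Q A B \<phi> p) = Ty (presheaves Q A) p"
      by (cases p) (simp add: lower_star_apply)
  next
    fix p p' assume pp': "p \<in> Obj (presheaves Q A)" "p' \<in> Obj (presheaves Q A)"
    obtain X \<mu> Y \<kappa> where [simp]: "p = (X, \<mu>)" "p' = (Y, \<kappa>)" by (metis surj_pair)
    have [simp]: "X \<in> Ob Q" "Y \<in> Ob Q"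
      and d [simp]: "qdistributor Q A (star Q X) \<mu>" "qdistributor Q A (star Q Y) \<kappa>"
      using pp' by auto
    note c = qdistributor_dist_imp[OF dist d(1)] qdistributor_dist_imp[OF dist d(2)]
    note [simp] = presheaf_closed[OF d(1)] presheaf_closed[OF d(2)] presheaves_Arr_closed[OF d]
      presheaf_closed[OF c(1)] presheaf_closed[OF c(2)] presheaves_Arr_closed[OF c]
    let ?q = "dist_imp Q A (star Q X) (star Q Y) \<kappa> \<mu> () ()"
    let ?m = "\<lambda>y. dist_imp Q A B (star Q X) \<mu> \<phi> y ()"
    have "Comp Q (Ty B y) X Y ?q (?m y)
        \<sqsubseteq>\<^bsub>Hom Q (Ty B y) Y\<^esub> dist_imp Q A B (star Q Y) \<kappa> \<phi> y ()"
      if [simp]: "y \<in> Obj B" for y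
    proof -
      have "Comp Q (Ty A x) (Ty B y) Y (Comp Q (Ty B y) X Y ?q (?m y)) (\<phi> x y)
          \<sqsubseteq>\<^bsub>Hom Q (Ty A x) Y\<^esub> \<kappa> x ()" if [simp]: "x \<in> Obj A" for x
      proof (rule dom.hom_le_trans)
        show "Comp Q (Ty A x) (Ty B y) Y (Comp Q (Ty B y) X Y ?q (?m y)) (\<phi> x y)
            \<sqsubseteq>\<^bsub>Hom Q (Ty A x) Y\<^esub> Comp Q (Ty A x) X Y ?q (\<mu> x ())"
          using dist_imp_Comp_le[OF dist d(1), of x y "()"]
          by (simp flip: dom.Comp_assoc add: dom.Comp_mono_right)
      qed (simp_all add: presheaves_Arr_Comp_le)
      then show ?thesis
        using le_dist_imp_iff[OF dist d(2), of y "()" "Comp Q (Ty B y) X Y ?q (?m y)"] by simp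
    qed
    then show "Arr (presheaves Q A) p p'
        \<sqsubseteq>\<^bsub>Hom Q (Ty (presheaves Q A) p) (Ty (presheaves Q A) p')\<^esub>
        Arr (presheaves Q B) (lower_star Q A B \<phi> p) (lower_star Q A B \<phi> p')"
      by (simp add: lower_star_apply le_presheaves_Arr_iff[OF c])
  qed
qed

text \<open>
  Unit and counit are \<open>\<kappa> \<le> (\<kappa> \<circ> \<phi>) \<swarrow> \<phi>\<close> and \<open>(\<mu> \<swarrow> \<phi>) \<circ> \<phi> \<le> \<mu>\<close>. By the universal properties of
  implication and of composition they reduce to the bounds \<open>le_dist_comp\<close> and \<open>dist_imp_Comp_le\<close>.
\<close>

lemma qadjunction_upper_lower_star:
  "qadjunction Q (presheaves Q B) (presheaves Q A) (upper_star Q A B \<phi>) (lower_star Q A B \<phi>)"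
proof -
  interpret U: qfunctor Q "presheaves Q B" "presheaves Q A" "upper_star Q A B \<phi>"
    by (rule qfunctor_upper_star)
  interpret L: qfunctor Q "presheaves Q A" "presheaves Q B" "lower_star Q A B \<phi>"
    by (rule qfunctor_lower_star)
  note dist = qdistributor_axioms
  show ?thesis
  proof
    show "functor_le Q (presheaves Q B) (presheaves Q B) (\<lambda>p\<in>Obj (presheaves Q B). p)
        (compose (Obj (presheaves Q B)) (lower_star Q A B \<phi>) (upper_star Q A B \<phi>))"
      unfolding functor_le_def
    proof
      fix p assume p: "p \<in> Obj (presheaves Q B)"
      obtain X \<kappa> where [simp]: "p = (X, \<kappa>)" by (metis surj_pair)
      have [simp]: "X \<in> Ob Q" and d [simp]: "qdistributor Q B (star Q X) \<kappa>" using p by auto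
      note c [simp] = qdistributor_dist_comp[OF dist d]
      note i [simp] = qdistributor_dist_imp[OF dist c]
      have "\<kappa> y () \<sqsubseteq>\<^bsub>Hom Q (Ty B y) X\<^esub>
          dist_imp Q A B (star Q X) (dist_comp Q A B (star Q X) \<kappa> \<phi>) \<phi> y ()" if "y \<in> Obj B" for y
        using that le_dist_imp_iff[OF dist c, of y "()" "\<kappa> y ()"]
          le_dist_comp[OF dist d, of _ y "()"] by (simp add: presheaf_closed[OF d])
      then show "underlying_le Q (presheaves Q B) ((\<lambda>p\<in>Obj (presheaves Q B). p) p)
          (compose (Obj (presheaves Q B)) (lower_star Q A B \<phi>) (upper_star Q A B \<phi>) p)"
        using p by (simp add: compose_def upper_star_apply lower_star_apply
            underlying_le_presheaves_iff)
    qed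
  next
    show "functor_le Q (presheaves Q A) (presheaves Q A)
        (compose (Obj (presheaves Q A)) (upper_star Q A B \<phi>) (lower_star Q A B \<phi>))
        (\<lambda>p\<in>Obj (presheaves Q A). p)"
      unfolding functor_le_def
    proof
      fix p assume p: "p \<in> Obj (presheaves Q A)"
      obtain X \<mu> where [simp]: "p = (X, \<mu>)" by (metis surj_pair)
      have [simp]: "X \<in> Ob Q" and d [simp]: "qdistributor Q A (star Q X) \<mu>" using p by auto
      note i [simp] = qdistributor_dist_imp[OF dist d]
      note c [simp] = qdistributor_dist_comp[OF dist i]
      have "dist_comp Q A B (star Q X) (dist_imp Q A B (star Q X) \<mu> \<phi>) \<phi> x ()
          \<sqsubseteq>\<^bsub>Hom Q (Ty A x) X\<^esub> \<mu> x ()" if "x \<in> Obj A" for x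
        using that dist_comp_le_iff[OF dist i, of x "()" "\<mu> x ()"]
          dist_imp_Comp_le[OF dist d, of x _ "()"] by (simp add: presheaf_closed[OF d])
      then show "underlying_le Q (presheaves Q A)
          (compose (Obj (presheaves Q A)) (upper_star Q A B \<phi>) (lower_star Q A B \<phi>) p)
          ((\<lambda>p\<in>Obj (presheaves Q A). p) p)"
        using p by (simp add: compose_def upper_star_apply lower_star_apply
            underlying_le_presheaves_iff)
    qed
  qed
qed

end

section \<open>Inverse image\<close>

lemma inverse_image_eq_upper_star_graph:
  "inverse_image Q A B F = upper_star Q A B (graph A B F)"
  by (simp add: inverse_image_def upper_star_def)

text \<open>
  The Yoneda lemma at \<open>F x\<close>: the term \<open>y = F x\<close> of the meet, evaluated at \<open>1 \<le> B(F x, F x)\<close>, bounds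
  the implication by \<open>\<kappa>(F x)\<close>, and \<open>\<kappa>(F x)\<close> is a lower bound because \<open>\<kappa>(F x) \<circ> B(y, F x) \<le> \<kappa>(y)\<close>.
\<close>

lemma (in qfunctor) dist_imp_cograph:
  assumes [simp]: "X \<in> Ob Q" and \<kappa>: "qdistributor Q B (star Q X) \<kappa>" and [simp]: "x \<in> Obj A"
  shows "dist_imp Q B A (star Q X) \<kappa> (cograph A B F) x () = \<kappa> (F x) ()" (is "?i = _")
proof -
  interpret \<kappa>: qdistributor Q B "star Q X" \<kappa> by fact
  have [simp]: "\<kappa> (F x) () \<in> carrier (Hom Q (Ty A x) X)"
    using presheaf_closed[OF \<kappa>, of "F x"] by (simp add: map_Ty)
  have [simp]: "?i \<in> carrier (Hom Q (Ty A x) X)"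
    using dist_imp_closed[OF qdistributor_cograph \<kappa>, of x "()"] by simp
  show ?thesis
  proof (rule dom.hom_le_antisym)
    have "?i = Comp Q (Ty A x) (Ty A x) X ?i (Ident Q (Ty A x))"
      by (simp add: dom.Comp_Ident_right)
    also have "\<dots> \<sqsubseteq>\<^bsub>Hom Q (Ty A x) X\<^esub> Comp Q (Ty A x) (Ty A x) X ?i (Arr B (F x) (F x))"
      using cod.Arr_Ident[of "F x"] by (intro dom.Comp_mono_right) (simp_all add: map_Ty)
    finally show "?i \<sqsubseteq>\<^bsub>Hom Q (Ty A x) X\<^esub> \<kappa> (F x) ()"
    proof (rule dom.hom_le_trans)
      show "Comp Q (Ty A x) (Ty A x) X ?i (Arr B (F x) (F x))
          \<sqsubseteq>\<^bsub>Hom Q (Ty A x) X\<^esub> \<kappa> (F x) ()"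
        using dist_imp_Comp_le[OF qdistributor_cograph \<kappa>, of "F x" x "()"]
        by (simp add: map_Ty cograph_def)
    qed simp_all
  next
    show "\<kappa> (F x) () \<sqsubseteq>\<^bsub>Hom Q (Ty A x) X\<^esub> ?i"
      using le_dist_imp_iff[OF qdistributor_cograph \<kappa>, of x "()" "\<kappa> (F x) ()"]
        \<kappa>.dist_dom[of _ "F x" "()"] by (simp add: cograph_def map_Ty)
  qed simp_all
qed

lemma (in qfunctor) lower_star_cograph: "lower_star Q B A (cograph A B F) = inverse_image Q A B F"
proof
  interpret C: qdistributor Q B A "cograph A B F" by (rule qdistributor_cograph)
  fix p :: "('y, 'o, 'q) presheaf"
  obtain X \<kappa> where p: "p = (X, \<kappa>)" by (metis surj_pair)
  show "lower_star Q B A (cograph A B F) p = inverse_image Q A B F p"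
  proof (cases "p \<in> Obj (presheaves Q B)")
    case True
    then have "X \<in> Ob Q" "qdistributor Q B (star Q X) \<kappa>" by (simp_all add: p)
    \<comment> \<open>Off \<open>Obj A\<close> both families are \<open>undefined\<close>, so pointwise equality on \<open>Obj A\<close> suffices.\<close>
    then have "dist_imp Q B A (star Q X) \<kappa> (cograph A B F) = (\<lambda>x\<in>Obj A. \<lambda>u\<in>{()}. \<kappa> (F x) u)"
      by (auto simp: fun_eq_iff dist_imp_cograph restrict_def) (simp add: dist_imp_def)
    then show ?thesis
      using True C.lower_star_apply[of X \<kappa>] inverse_image_apply[of X \<kappa>] by (simp add: p)
  next
    case False
    then show ?thesis by (simp add: lower_star_def inverse_image_def)
  qed
qed

theorem theorem5p4:
  fixes Q :: "('o, 'q) quantaloid_data"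
    and A :: "('x, 'o, 'q) qcat"
    and B :: "('y, 'o, 'q) qcat"
    and F :: "'x \<Rightarrow> 'y"
  assumes "quantaloid Q"
    and "qcategory Q A"
    and "qcategory Q B"
    and "qfunctor Q A B F"
  shows "lower_star Q B A (cograph A B F) = inverse_image Q A B F
    \<and> inverse_image Q A B F = upper_star Q A B (graph A B F)
    \<and> qadjunction Q (presheaves Q A) (presheaves Q B)
        (upper_star Q B A (cograph A B F)) (inverse_image Q A B F)
    \<and> qadjunction Q (presheaves Q B) (presheaves Q A)
        (inverse_image Q A B F) (lower_star Q A B (graph A B F))"
proof -
  interpret F: qfunctor Q A B F by fact
  show ?thesis
    using qdistributor.qadjunction_upper_lower_star[OF F.qdistributor_graph]
      qdistributor.qadjunction_upper_lower_star[OF F.qdistributor_cograph]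
      F.lower_star_cograph inverse_image_eq_upper_star_graph[of Q A B F]
    by simp
qed

end
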